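(* Let $s,t$ be real numbers with $s\neq0$, $t\neq0$. For every positive integer $n$, \[ \sum_{k=1}^{n}t^{2(n-k)}\left(\frac{\{k+1\}_{s,t}+t\{k-1\}_{s,t}}{s}\right)\{k\}_{s,t}^3=\genfrac{\{}{\}}{0pt}{}{n+1}{2}_{s,t}^2. \]
   Context: The generalized Fibonacci polynomials $\{n\}_{s,t}$ are defined by $\{0\}_{s,t}=0$, $\{1\}_{s,t}=1$, $\{n+2\}_{s,t}=s\{n+1\}_{s,t}+t\{n\}_{s,t}$ (so $\{2\}_{s,t}=s$). The generalized triangular numbers are $\genfrac{\{}{\}}{0pt}{}{m}{2}_{s,t}=\frac{\{m-1\}_{s,t}\{m\}_{s,t}}{\{2\}_{s,t}}$ for integers $m\geq1$. *)

theory Defs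
  imports Complex_Main
begin

fun gen_fib :: "real \<Rightarrow> real \<Rightarrow> nat \<Rightarrow> real" where
  "gen_fib s t 0 = 0"
| "gen_fib s t (Suc 0) = 1"
| "gen_fib s t (Suc (Suc n)) = s * gen_fib s t (Suc n) + t * gen_fib s t n"

(* Meant for m \<ge> 1 only, where the subtraction m - 1 on nat is exact,
   and for gen_fib s t 2 = s \<noteq> 0. *)
definition gen_triangular :: "real \<Rightarrow> real \<Rightarrow> nat \<Rightarrow> real" where
  "gen_triangular s t m = gen_fib s t (m - 1) * gen_fib s t m / gen_fib s t 2"

end

theory Submission
  imports Defs
begin

text \<open>Since \<open>{k+1} - t {k-1} = s {k}\<close>, the difference of squares
  \<open>{k+1}\<^sup>2 - t\<^sup>2 {k-1}\<^sup>2\<close> equals \<open>s {k} ({k+1} + t {k-1})\<close>. Multiplied by \<open>{k}\<^sup>2 / s\<^sup>2\<close>, this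
  shows that the squared triangular numbers satisfy the same first-order recurrence with
  factor \<open>t\<^sup>2\<close> as the sums.\<close>

lemma gen_triangular_Suc:
  "gen_triangular s t (Suc n) = gen_fib s t n * gen_fib s t (Suc n) / s"
  by (simp add: gen_triangular_def numeral_2_eq_2)

lemma gen_triangular_square_rec:
  assumes "s \<noteq> 0"
  shows "(gen_triangular s t (Suc (Suc n)))\<^sup>2 =
    t\<^sup>2 * (gen_triangular s t (Suc n))\<^sup>2
    + (gen_fib s t (Suc (Suc n)) + t * gen_fib s t n) / s * gen_fib s t (Suc n) ^ 3"
  unfolding gen_triangular_Suc using assms
  by (simp add: field_simps power2_eq_square power3_eq_cube)

theorem theorem4:
  fixes s t :: real and n :: nat
  assumes "s \<noteq> 0" and "t \<noteq> 0" and "n \<ge> 1"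
  shows "(\<Sum>k=1..n. t ^ (2 * (n - k)) * ((gen_fib s t (k + 1) + t * gen_fib s t (k - 1)) / s)
            * gen_fib s t k ^ 3)
         = (gen_triangular s t (n + 1))\<^sup>2"
proof -
  \<comment> \<open>The weight \<open>t ^ (2 * (n - k))\<close> stays outside \<open>g\<close>: it
    alone depends on the upper limit, so \<open>g\<close> is fixed throughout the induction.\<close>
  define g where "g k = (gen_fib s t (k + 1) + t * gen_fib s t (k - 1)) / s * gen_fib s t k ^ 3" for k
  have "(\<Sum>k=1..n. t ^ (2 * (n - k)) * g k) = (gen_triangular s t (Suc n))\<^sup>2"
  proof (induction n)
    case 0
    \<comment> \<open>The sum is empty, and the triangular number at index 1 contains the factor
      \<open>gen_fib s t 0 = 0\<close>.\<close>
    show ?case by (simp add: gen_triangular_def)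
  next
    case (Suc n)
    \<comment> \<open>Raising the upper limit multiplies each old weight by
      \<open>t\<^sup>2\<close>, as \<open>Suc n - k = Suc (n - k)\<close> for
      \<open>k \<le> n\<close>. The new term \<open>k = Suc n\<close> has weight 1 and supplies the
      last summand of the recurrence.\<close>
    have "(\<Sum>k=1..n. t ^ (2 * (Suc n - k)) * g k) = t\<^sup>2 * (\<Sum>k=1..n. t ^ (2 * (n - k)) * g k)"
      unfolding sum_distrib_left
      by (rule sum.cong) (simp_all add: Suc_diff_le power2_eq_square)
    then show ?case
      using gen_triangular_square_rec[OF assms(1), of t n] Suc.IH by (simp add: g_def)
  qed
  then show ?thesis by (simp add: g_def mult.assoc)
qed

end
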